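(* Let $k\ge 2$ and $n\ge n_0(k)$ be integers, and for $\lambda\in\Gamma_{n,k}$ (with $P(\lambda)>0$) let $A_\lambda$ be the discrete spherical average of degree $k$ along the primes, $$A_\lambda f(\mathbf l)=\frac1{P(\lambda)}\sum_{\substack{\mathbf p\ \text{prime vector}\\ p_1^k+\dots+p_n^k=\lambda}}(\log p_1)\cdots(\log p_n)\,f(\mathbf p-\mathbf l),\qquad \mathbf l\in\mathbb Z^n .$$ Let $1<p<2$ and let $p'$ be the conjugate exponent, $1/p+1/p'=1$. (i) If $k\ge 3$, then for every $B>0$ there is a constant $C_{B,p,n,k}$, independent of $\lambda$ and $f$, such that for all $\lambda\in\Gamma_{n,k}$ with $P(\lambda)>0$ and all $f\in \ell^p(\mathbb Z^n)$, $$\|A_\lambda f\|_{\ell^{p'}(\mathbb Z^n)}\le C_{B,p,n,k}\,\lambda^{(1-\frac nk)(\frac2p-1)}(\log\lambda)^{-B}\,\|f\|_{\ell^p(\mathbb Z^n)} .$$ (ii) If $k=2$, then there is a constant $C_{p,n}$, independent of $\lambda$ and $f$, such that for all $\lambda\in\Gamma_{n,2}$ with $P(\lambda)>0$ and all $f\in\ell^p(\mathbb Z^n)$, $$\|A_\lambda f\|_{\ell^{p'}(\mathbb Z^n)}\le C_{p,n}\,\lambda^{(1-\frac n2)(\frac2p-1)}(\log\lambda)^{n}\,\|f\|_{\ell^p(\mathbb Z^n)} .$$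
   Context: A prime vector is $\mathbf p=(p_1,\dots,p_n)\in\mathbb Z^n$ all of whose coordinates are prime numbers. The weighted number of prime solutions is $$P(\lambda)=\sum_{p_1^k+\dots+p_n^k=\lambda}(\log p_1)\cdots(\log p_n),$$ the sum being over prime vectors. The threshold $n_0(k)$ is defined by $n_0(k)=2^k+1$ for $k=2,3,4$, and, for $k\ge5$, $$n_0(k)=k^2+3-\max_{1\le j\le k-1}\left\lceil\frac{kj-\min(2^j,j^2+j)}{k-j+1}\right\rceil .$$ $\Gamma_{n,k}\subset\mathbb N$ is a fixed infinite arithmetic progression along which Hua's asymptotic for the Waring--Goldbach problem holds: as $\lambda\to\infty$ in $\Gamma_{n,k}$, $P(\lambda)\sim\mathfrak S_{n,k}(\lambda)\lambda^{n/k-1}$, where the singular series $\mathfrak S_{n,k}(\lambda)$ can be regarded as a constant, i.e. it is bounded above and below by positive constants independent of $\lambda\in\Gamma_{n,k}$. *)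

theory Defs
  imports
    "HOL-Analysis.Analysis"
    "HOL-Number_Theory.Number_Theory"
    "HOL-Library.Landau_Symbols"
begin

text \<open>The lattice of integer points of dimension \<open>n\<close> is the type \<open>int ^ 'n\<close> with
  \<open>n = CARD('n)\<close>.\<close>

definition n\<^sub>0 :: "nat \<Rightarrow> int" where
  "n\<^sub>0 k = (if k \<le> 4 then 2 ^ k + 1
     else int k ^ 2 + 3 -
       Max ((\<lambda>j. \<lceil>(real k * real j - min (2 ^ j) (real j ^ 2 + real j)) / (real k - real j + 1)\<rceil>)
             ` {1..k - 1}))"

definition prime_vectors :: "nat \<Rightarrow> nat \<Rightarrow> (int ^ 'n) set" where
  "prime_vectors k N = {v. (\<forall>i. prime (v $ i)) \<and> (\<Sum>i\<in>UNIV. (v $ i) ^ k) = int N}"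

definition log_weight :: "int ^ 'n \<Rightarrow> real" where
  "log_weight v = (\<Prod>i\<in>UNIV. ln (real_of_int (v $ i)))"

definition prime_rep :: "'n::finite itself \<Rightarrow> nat \<Rightarrow> nat \<Rightarrow> real" where
  "prime_rep _ k N = (\<Sum>v\<in>(prime_vectors k N :: (int ^ 'n) set). log_weight v)"

definition prime_avg :: "nat \<Rightarrow> nat \<Rightarrow> (int ^ 'n::finite \<Rightarrow> complex) \<Rightarrow> (int ^ 'n \<Rightarrow> complex)" where
  "prime_avg k N f l =
     (1 / prime_rep TYPE('n) k N) *\<^sub>R (\<Sum>v\<in>prime_vectors k N. log_weight v *\<^sub>R f (v - l))"

definition in_lp :: "real \<Rightarrow> ('a \<Rightarrow> complex) \<Rightarrow> bool" where
  "in_lp p f \<longleftrightarrow> (\<lambda>x. norm (f x) powr p) summable_on UNIV"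

text \<open>Meaningful only together with \<open>in_lp p f\<close>: a divergent \<open>infsum\<close> is \<open>0\<close>.\<close>

definition lp_norm :: "real \<Rightarrow> ('a \<Rightarrow> complex) \<Rightarrow> real" where
  "lp_norm p f = (\<Sum>\<^sub>\<infinity>x. norm (f x) powr p) powr (1 / p)"

definition reduced_exp_sum :: "nat \<Rightarrow> nat \<Rightarrow> nat \<Rightarrow> complex" where
  "reduced_exp_sum k q a =
     (\<Sum>x | x \<in> {1..q} \<and> coprime x q. cis (2 * pi * (real a * real x ^ k / real q)))"

text \<open>The singular series of the Waring--Goldbach problem for \<open>n\<close> \<open>k\<close>-th powers of primes.
  The Gamma quotient is the density at the infinite place, so that the expected main term for the
  logarithmically weighted count is \<open>singular_series n k N * N powr (n / k - 1)\<close> with no further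
  constant. The sum over \<open>q\<close> is real, since the terms for \<open>a\<close> and \<open>q - a\<close> are conjugate.\<close>

definition singular_series :: "nat \<Rightarrow> nat \<Rightarrow> nat \<Rightarrow> real" where
  "singular_series n k N =
     Gamma (1 + 1 / real k) ^ n / Gamma (real n / real k) *
     Re (\<Sum>\<^sub>\<infinity>q\<in>{1..}. \<Sum>a | a \<in> {1..q} \<and> coprime a q.
           (reduced_exp_sum k q a / of_nat (totient q)) ^ n * cis (- 2 * pi * (real a * real N / real q)))"

definition arith_progression :: "nat set \<Rightarrow> bool" where
  "arith_progression \<Gamma> \<longleftrightarrow> (\<exists>a d. d > 0 \<and> \<Gamma> = {a + d * m | m. True})"

definition hua_progression :: "'n::finite itself \<Rightarrow> nat \<Rightarrow> nat set \<Rightarrow> bool" where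
  "hua_progression _ k \<Gamma> \<longleftrightarrow>
     arith_progression \<Gamma> \<and>
     prime_rep TYPE('n) k \<sim>[inf at_top (principal \<Gamma>)]
       (\<lambda>N. singular_series CARD('n) k N * real N powr (real CARD('n) / real k - 1)) \<and>
     (\<exists>c C. 0 < c \<and> (\<forall>N\<in>\<Gamma>. c \<le> singular_series CARD('n) k N \<and> singular_series CARD('n) k N \<le> C))"

end

theory Submission imports Defs begin

text \<open>A power of \<open>N\<close> is saved over the interpolation of the trivial \<open>\<ell>\<^sup>2\<close> and
  \<open>\<ell>\<^sup>1 \<rightarrow> \<ell>\<^sup>\<infinity>\<close> bounds, which absorbs every power of \<open>ln N\<close>. The interpolated bound can only be
  sharp if there are sets \<open>E\<close>, \<open>F\<close> of about \<open>N powr (n / k - 1)\<close> points such that \<open>x + y\<close> is a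
  solution for most \<open>(x, y) \<in> E \<times> F\<close>. This is excluded by counting stars, in the manner of
  Kovari, Sos and Turan: the equations \<open>\<Sum>\<^sub>i (x\<^sub>i + y\<^sub>i) ^ k = N\<close> in \<open>y\<close> have coefficient
  vectors in a space of bounded dimension, so among boundedly many of them one is implied by the
  others, and by strict convexity no three solutions are in arithmetic progression, so sums
  \<open>x + y\<close> with \<open>(x, y)\<close> in a set of the form \<open>A \<times> B\<close> inside the solution set are distinct.\<close>

section \<open>Linear relations among the equations of the solution set\<close>

text \<open>Gaussian elimination, one coordinate \<open>q\<close> at a time: an index
  \<open>i\<close> with \<open>c i q\<close> nonzero clears \<open>q\<close> from the other vectors,
  and its own coefficient is then solved for so that a relation among the reduced vectors lifts to
  the original ones.\<close>

lemma nontrivial_linear_relation: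
  fixes c :: "'j \<Rightarrow> 'q \<Rightarrow> 'a::field"
  assumes "finite Q" "finite J" "card Q < card J"
  shows "\<exists>u. (\<exists>j\<in>J. u j \<noteq> 0) \<and> (\<forall>q\<in>Q. (\<Sum>j\<in>J. u j * c j q) = 0)"
  using assms
proof (induction Q arbitrary: J c rule: finite_induct)
  case empty
  then have "J \<noteq> {}" by auto
  then show ?case by (intro exI[of _ "\<lambda>_. 1"]) auto
next
  case (insert q Q)
  show ?case
  proof (cases "\<forall>j\<in>J. c j q = 0")
    case True
    with insert.IH[of J c] insert.prems insert.hyps show ?thesis by auto
  next
    case False
    then obtain i where i: "i \<in> J" "c i q \<noteq> 0" by blast
    define c' where "c' j r = c j r - c j q / c i q * c i r" for j r
    have "card Q < card (J - {i})"
      using insert.prems insert.hyps i by simp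
    with insert.IH[of "J - {i}" c'] insert.prems obtain u where
      u: "\<exists>j\<in>J - {i}. u j \<noteq> 0" "\<forall>r\<in>Q. (\<Sum>j\<in>J - {i}. u j * c' j r) = 0"
      by auto
    define v where "v j = (if j = i then - (\<Sum>j\<in>J - {i}. u j * c j q) / c i q else u j)" for j
    have *: "(\<Sum>j\<in>J. v j * c j r) = (\<Sum>j\<in>J - {i}. u j * c' j r)" for r
    proof -
      have "(\<Sum>j\<in>J. v j * c j r) = v i * c i r + (\<Sum>j\<in>J - {i}. v j * c j r)"
        using i insert.prems by (simp add: sum.remove)
      also have "(\<Sum>j\<in>J - {i}. v j * c j r) = (\<Sum>j\<in>J - {i}. u j * c j r)"
        by (intro sum.cong) (auto simp: v_def)
      also have "v i * c i r = - ((\<Sum>j\<in>J - {i}. u j * c j q) * (c i r / c i q))"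
        by (simp add: v_def)
      also have "\<dots> = - (\<Sum>j\<in>J - {i}. u j * (c j q / c i q * c i r))"
        by (simp only: sum_distrib_right) (simp add: ac_simps)
      finally show ?thesis
        by (simp add: c'_def algebra_simps sum_subtractf)
    qed
    have "c' j q = 0" for j using i by (simp add: c'_def)
    then have "\<forall>r\<in>insert q Q. (\<Sum>j\<in>J. v j * c j r) = 0"
      using u(2) by (auto simp: *)
    moreover have "\<exists>j\<in>J. v j \<noteq> 0" using u(1) by (auto simp: v_def)
    ultimately show ?thesis by blast
  qed
qed

text \<open>Primality is relaxed to positivity because the argument builds new solutions as sums
  \<open>x + y\<close>. Positivity can be carried over to these and is all that strict convexity
  requires.\<close>

definition pos_solutions :: "nat \<Rightarrow> nat \<Rightarrow> (int ^ 'n) set" where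
  "pos_solutions k N = {x. (\<forall>i. 0 < x $ i) \<and> (\<Sum>i\<in>UNIV. (x $ i) ^ k) = int N}"

lemma binomial_expand_real:
  fixes a b :: int
  shows "real_of_int ((a + b) ^ k) =
    (\<Sum>l\<le>k. (of_nat (k choose l) * of_int a ^ (k - l)) * of_int b ^ l)"
proof -
  have "real_of_int ((a + b) ^ k) = (of_int b + of_int a) ^ k" by (simp add: add.commute)
  also have "\<dots> = (\<Sum>l\<le>k. (of_nat (k choose l) * of_int a ^ (k - l)) * of_int b ^ l)"
    by (subst binomial_ring) (simp add: mult_ac)
  finally show ?thesis .
qed

text \<open>Expanded in \<open>y\<close>, each equation has a coefficient vector with
  \<open>CARD('n) * (k + 1)\<close> entries, so more than that many equations are linearly dependent
  and one with a nonzero coefficient follows from the others. Setting aside one minimising index per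
  coordinate first, at most \<open>CARD('n)\<close> in all, ensures that the pivot is nowhere the
  unique minimum. This passes positivity of the other sums \<open>e i + y\<close> on to
  \<open>e j + y\<close>.\<close>

lemma pivot_exists:
  fixes e :: "nat \<Rightarrow> int ^ 'n::finite"
  assumes m: "m = CARD('n) * (k + 2) + 1"
  shows "\<exists>j<m. (\<forall>c. \<exists>i<m. i \<noteq> j \<and> e i $ c \<le> e j $ c) \<and>
    (\<forall>y. (\<forall>i<m. i \<noteq> j \<longrightarrow> (\<Sum>c\<in>UNIV. ((e i + y) $ c) ^ k) = N) \<longrightarrow>
       (\<Sum>c\<in>UNIV. ((e j + y) $ c) ^ k) = N)"
proof -
  have "\<exists>i<m. \<forall>j<m. e i $ c \<le> e j $ c" for c
  proof -
    have "Min ((\<lambda>i. e i $ c) ` {..<m}) \<in> (\<lambda>i. e i $ c) ` {..<m}"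
      by (rule Min_in) (auto simp: m lessThan_empty_iff)
    then obtain i where i: "i < m" "e i $ c = Min ((\<lambda>i. e i $ c) ` {..<m})" by auto
    have "e i $ c \<le> e j $ c" if "j < m" for j
      unfolding i(2) using that by (intro Min_le) auto
    with i show ?thesis by blast
  qed
  then obtain t where t: "\<And>c. t c < m" "\<And>c j. j < m \<Longrightarrow> e (t c) $ c \<le> e j $ c"
    by metis
  define J where "J = {..<m} - range t"
  have J: "finite J" "J \<subseteq> {..<m}" by (auto simp: J_def)
  have "card (range t) \<le> CARD('n)" by (rule card_image_le) simp
  moreover have "card J = m - card (range t)"
    unfolding J_def using t(1) by (subst card_Diff_subset) auto
  ultimately have cJ: "card ((UNIV :: 'n set) \<times> {..k}) < card J"
    by (simp add: m card_cartesian_product)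
  obtain u where u: "\<exists>j\<in>J. u j \<noteq> 0"
    "\<forall>q\<in>(UNIV :: 'n set) \<times> {..k}.
       (\<Sum>j\<in>J. u j * (case q of (c, l) \<Rightarrow> of_nat (k choose l) * real_of_int (e j $ c) ^ (k - l))) = 0"
    using nontrivial_linear_relation[OF _ J(1) cJ,
        of "\<lambda>j q. case q of (c, l) \<Rightarrow> of_nat (k choose l) * real_of_int (e j $ c) ^ (k - l)"] by auto
  have u2: "(\<Sum>j\<in>J. u j * (of_nat (k choose l) * real_of_int (e j $ c) ^ (k - l))) = 0"
    if "l \<le> k" for c l
    using u(2) that by (auto dest!: bspec[of _ _ "(c, l)"])
  from u(1) obtain j where j: "j \<in> J" "u j \<noteq> 0" by blast
  \<comment> \<open>For \<open>l = k\<close> the coefficient is 1, so the relation also annihilates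
    the constant right-hand sides \<open>N\<close>.\<close>
  have su: "sum u J = 0" using u2[of k] by simp
  have rel: "(\<Sum>j\<in>J. u j * real_of_int (\<Sum>c\<in>UNIV. ((e j + y) $ c) ^ k)) = 0" for y
  proof -
    have "(\<Sum>j\<in>J. u j * real_of_int (\<Sum>c\<in>UNIV. ((e j + y) $ c) ^ k)) =
      (\<Sum>j\<in>J. \<Sum>c\<in>UNIV. \<Sum>l\<le>k.
         (u j * (of_nat (k choose l) * real_of_int (e j $ c) ^ (k - l))) * of_int (y $ c) ^ l)"
      unfolding of_int_sum vector_add_component binomial_expand_real
      by (simp add: sum_distrib_left mult.assoc)
    also have "\<dots> = (\<Sum>c\<in>UNIV. \<Sum>l\<le>k. \<Sum>j\<in>J.
         (u j * (of_nat (k choose l) * real_of_int (e j $ c) ^ (k - l))) * of_int (y $ c) ^ l)"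
      by (rule trans[OF sum.swap], rule sum.cong[OF refl], rule sum.swap)
    also have "\<dots> = 0"
      unfolding sum_distrib_right[symmetric] by (simp add: u2)
    finally show ?thesis .
  qed
  show ?thesis
  proof (rule exI[of _ j], intro conjI allI impI)
    show "j < m" using j J by auto
    show "\<exists>i<m. i \<noteq> j \<and> e i $ c \<le> e j $ c" for c
      using t(1)[of c] t(2)[of j c] j by (intro exI[of _ "t c"]) (auto simp: J_def)
    fix y assume y: "\<forall>i<m. i \<noteq> j \<longrightarrow> (\<Sum>c\<in>UNIV. ((e i + y) $ c) ^ k) = N"
    let ?\<Phi> = "\<lambda>i. real_of_int (\<Sum>c\<in>UNIV. ((e i + y) $ c) ^ k)"
    have "0 = (\<Sum>i\<in>J. u i * (?\<Phi> i - of_int N))"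
      using rel[of y] su by (simp add: right_diff_distrib sum_subtractf sum_distrib_right[symmetric])
    also have "\<dots> = u j * (?\<Phi> j - of_int N) + (\<Sum>i\<in>J - {j}. u i * (?\<Phi> i - of_int N))"
      using j J by (simp add: sum.remove)
    also have "(\<Sum>i\<in>J - {j}. u i * (?\<Phi> i - of_int N)) = 0"
      using J y by (intro sum.neutral ballI) (auto simp: subset_iff)
    finally have "?\<Phi> j = of_int N" using j by simp
    then show "(\<Sum>c\<in>UNIV. ((e j + y) $ c) ^ k) = N" by linarith
  qed
qed


section \<open>Strict convexity and solutions in arithmetic progression\<close>

text \<open>Induction on \<open>k\<close> from the square. The inductive step is Chebyshev's sum
  inequality, which amounts to \<open>(b - a) * (b ^ k - a ^ k)\<close> being nonnegative.\<close>

lemma power_midpoint_strict: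
  fixes a b :: real
  assumes "0 < a" "0 < b" "a \<noteq> b" "2 \<le> k"
  shows "2 * ((a + b) / 2) ^ k < a ^ k + b ^ k"
proof -
  have *: "2 * ((a + b) / 2) ^ k < a ^ k + b ^ k" if "0 < a" "a < b" for a b :: real
    using \<open>2 \<le> k\<close>
  proof (induction k rule: dec_induct)
    case base
    have "0 < (b - a)\<^sup>2" using that by simp
    then show ?case by (simp add: power2_eq_square field_simps)
  next
    case (step k)
    have "2 * ((a + b) / 2) ^ Suc k = (a + b) / 2 * (2 * ((a + b) / 2) ^ k)" by simp
    also have "\<dots> < (a + b) / 2 * (a ^ k + b ^ k)"
      using step that by (intro mult_strict_left_mono) auto
    also have "\<dots> \<le> a ^ Suc k + b ^ Suc k"
    proof -
      have "0 \<le> (b - a) * (b ^ k - a ^ k)"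
        using that by (intro mult_nonneg_nonneg) (auto intro: power_mono)
      then show ?thesis by (simp add: field_simps)
    qed
    finally show ?case .
  qed
  show ?thesis
  proof (cases "a < b")
    case True with * assms show ?thesis by blast
  next
    case False
    then have "b < a" using assms by simp
    from *[OF \<open>0 < b\<close> this] show ?thesis by (simp add: add.commute)
  qed
qed

lemma power_midpoint_le:
  fixes a b :: real
  assumes "0 < a" "0 < b" "2 \<le> k"
  shows "2 * ((a + b) / 2) ^ k \<le> a ^ k + b ^ k"
  using power_midpoint_strict[of a b k] assms by (cases "a = b") auto

text \<open>At a coordinate where \<open>u\<close> and \<open>v\<close> differ the midpoint
  inequality is strict, and summing over the coordinates would give 2N < 2N.\<close>

lemma pos_solutions_midpoint_eq:
  fixes u v x :: "int ^ 'n::finite"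
  assumes "2 \<le> k" "u \<in> pos_solutions k N" "v \<in> pos_solutions k N" "x \<in> pos_solutions k N"
    and sum: "u + v = x + x"
  shows "u = v"
proof (rule ccontr)
  assume "u \<noteq> v"
  then obtain c where c: "u $ c \<noteq> v $ c" by (auto simp: vec_eq_iff)
  have x: "real_of_int (x $ i) = (real_of_int (u $ i) + real_of_int (v $ i)) / 2" for i
  proof -
    have "u $ i + v $ i = x $ i + x $ i" using sum by (metis vector_add_component)
    then have "real_of_int (u $ i + v $ i) = real_of_int (x $ i + x $ i)" by simp
    then show ?thesis by simp
  qed
  have pos: "0 < u $ i" "0 < v $ i" for i using assms by (auto simp: pos_solutions_def)
  have eq: "(\<Sum>i\<in>UNIV. real_of_int (w $ i) ^ k) = real N" if "w \<in> pos_solutions k N" for w :: "int ^ 'n"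
  proof -
    have "(\<Sum>i\<in>UNIV. (w $ i) ^ k) = int N" using that by (auto simp: pos_solutions_def)
    then have "real_of_int (\<Sum>i\<in>UNIV. (w $ i) ^ k) = real_of_int (int N)" by (rule arg_cong)
    then show ?thesis by simp
  qed
  have "(\<Sum>i\<in>UNIV. 2 * real_of_int (x $ i) ^ k)
      < (\<Sum>i\<in>UNIV. real_of_int (u $ i) ^ k + real_of_int (v $ i) ^ k)"
    unfolding x using pos c assms(1)
    by (intro sum_strict_mono_ex1) (auto intro!: power_midpoint_le exI[of _ c] power_midpoint_strict)
  then show False
    unfolding sum.distrib sum_distrib_left[symmetric] using eq assms by simp
qed

section \<open>Size of the solution set\<close>

lemma pos_solutions_bounds:
  assumes "x \<in> pos_solutions k N" "0 < k"
  shows "0 < x $ i" "real_of_int (x $ i) \<le> real N powr (1 / real k)"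
proof -
  show pos: "0 < x $ i" using assms by (auto simp: pos_solutions_def)
  have "(x $ i) ^ k \<le> (\<Sum>i\<in>UNIV. (x $ i) ^ k)"
    using assms by (intro member_le_sum) (auto simp: pos_solutions_def intro!: zero_le_power less_imp_le)
  then have "(x $ i) ^ k \<le> int N" using assms by (auto simp: pos_solutions_def)
  then have "real_of_int ((x $ i) ^ k) \<le> real_of_int (int N)" unfolding of_int_le_iff .
  then have "(real_of_int (x $ i)) ^ k \<le> real N" by simp
  then have "((real_of_int (x $ i)) ^ k) powr (1 / real k) \<le> real N powr (1 / real k)"
    using pos by (intro powr_mono2) auto
  moreover have "((real_of_int (x $ i)) ^ k) powr (1 / real k) = real_of_int (x $ i)"
    using pos assms by (simp add: powr_realpow[symmetric] powr_powr)
  ultimately show "real_of_int (x $ i) \<le> real N powr (1 / real k)" by simp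
qed

text \<open>The solutions lie in a box of side \<open>N powr (1 / k)\<close>. This crude count
  ignores the equation and so loses a factor of order N against the expected size, which is
  affordable because it will be compared with the square of that size.\<close>

lemma card_pos_solutions:
  assumes "0 < k"
  shows "finite (pos_solutions k N :: (int ^ 'n::finite) set)"
    "real (card (pos_solutions k N :: (int ^ 'n::finite) set)) \<le> real N powr (real CARD('n) / real k)"
proof -
  define r where "r = \<lfloor>real N powr (1 / real k)\<rfloor>"
  have r: "0 \<le> r" by (simp add: r_def)
  let ?S = "pos_solutions k N :: (int ^ 'n) set"
  let ?B = "(UNIV :: 'n set) \<rightarrow>\<^sub>E {1..r}"
  have fin: "finite ?B" by (intro finite_PiE) auto
  have inj: "inj_on (\<lambda>x. vec_nth x) ?S" by (rule inj_onI) (simp add: vec_nth_inject)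
  have sub: "(\<lambda>x. vec_nth x) ` ?S \<subseteq> ?B"
  proof (rule image_subsetI)
    fix x assume x: "x \<in> ?S"
    show "vec_nth x \<in> ?B"
    proof (rule PiE_I)
      show "x $ i \<in> {1..r}" for i
        using pos_solutions_bounds[OF x assms, of i] by (simp add: r_def le_floor_iff)
    qed simp
  qed
  show "finite ?S" by (rule finite_imageD[OF finite_subset[OF sub fin] inj])
  have "card ?S \<le> card ?B" by (rule card_inj_on_le[OF inj sub fin])
  also have "card ?B = nat r ^ CARD('n)" by (simp add: card_PiE)
  finally have "real (card ?S) \<le> real (nat r ^ CARD('n))" by (simp only: of_nat_le_iff)
  also have "\<dots> = real_of_int r ^ CARD('n)" using r by simp
  also have "\<dots> \<le> (real N powr (1 / real k)) ^ CARD('n)"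
    using r by (intro power_mono) (auto simp: r_def)
  also have "\<dots> = real N powr (real CARD('n) / real k)"
    by (cases "N = 0") (auto simp: powr_power)
  finally show "real (card ?S) \<le> real N powr (real CARD('n) / real k)" .
qed

section \<open>Counting stars in the incidence graph\<close>

text \<open>Jensen's inequality with equal weights. It converts a bound on the number of stars, a
  power sum of degrees, into a bound on the number of edges.\<close>

lemma power_sum_le_sum_power:
  fixes a :: "'b \<Rightarrow> real"
  assumes "finite F" "\<And>y. y \<in> F \<Longrightarrow> 0 \<le> a y"
  shows "(\<Sum>y\<in>F. a y) ^ Suc m \<le> real (card F) ^ m * (\<Sum>y\<in>F. a y ^ Suc m)"
proof (cases "F = {}")
  case False
  then have c: "0 < card F" using assms by (simp add: card_gt_0_iff)
  have "convex_on {0..} (\<lambda>x::real. x ^ Suc m)"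
    using convex_power_odd[of "Suc m"] convex_on_subset[OF convex_power_even[of "Suc m"]]
    by (cases "odd (Suc m)") auto
  from convex_on_sum[OF assms(1) False this, of "\<lambda>_. 1 / card F" a]
  have "((\<Sum>y\<in>F. a y) / card F) ^ Suc m \<le> (\<Sum>y\<in>F. a y ^ Suc m) / card F"
    using assms False c by (simp add: sum_divide_distrib del: power_Suc)
  then show ?thesis using c by (simp add: field_simps power_divide)
qed auto

text \<open>A tuple \<open>e\<close> of common neighbours of \<open>y\<close> has a pivot \<open>e j\<close>. All sums of an admissible
  pivot and a common neighbour of the other entries are positive solutions, and since no three
  solutions are in arithmetic progression, \<open>e j\<close> and \<open>y\<close> can be recovered from the other entries
  and \<open>e j + y\<close>.\<close>

lemma incidence_bound:
  fixes E F S :: "(int ^ 'n::finite) set"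
  assumes k: "2 \<le> k" and m: "m = CARD('n) * (k + 2) + 1"
    and fin: "finite E" "finite F" and S: "S \<subseteq> pos_solutions k N"
  shows "real (card {(x, y). x \<in> E \<and> y \<in> F \<and> x + y \<in> S}) ^ m
    \<le> real m * (real (card E) * real (card F)) ^ (m - 1)
        * real (card (pos_solutions k N :: (int ^ 'n) set))"
proof -
  let ?P = "pos_solutions k N :: (int ^ 'n) set"
  define nb where "nb y = {x\<in>E. x + y \<in> S}" for y
  \<comment> \<open>Stars with centre \<open>y\<close> and \<open>m\<close> leaves. Repeated leaves
    are allowed, so the number of stars is exactly the sum of the \<open>m\<close>-th powers of the
    degrees.\<close>
  define \<Theta> where "\<Theta> = (SIGMA y:F. {..<m} \<rightarrow>\<^sub>E nb y)"
  define piv where "piv e j \<longleftrightarrow> j < m \<and> (\<forall>c. \<exists>i<m. i \<noteq> j \<and> e i $ c \<le> e j $ c) \<and>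
    (\<forall>y. (\<forall>i<m. i \<noteq> j \<longrightarrow> (\<Sum>c\<in>UNIV. ((e i + y) $ c) ^ k) = int N) \<longrightarrow>
       (\<Sum>c\<in>UNIV. ((e j + y) $ c) ^ k) = int N)" for e :: "nat \<Rightarrow> int ^ 'n" and j
  define pv where "pv e = (SOME j. piv e j)" for e
  have pv: "piv e (pv e)" for e
  proof -
    have "\<exists>j. piv e j" using pivot_exists[OF m, of e "int N"] unfolding piv_def .
    then show ?thesis unfolding pv_def by (rule someI_ex)
  qed
  define \<psi> where "\<psi> = (\<lambda>(y, e). (pv e, restrict e ({..<m} - {pv e}), e (pv e) + y))"
  \<comment> \<open>The pivot leaf and the centre are replaced by their sum, a single element of
    \<open>?P\<close>. This is where the count gains over the trivial one.\<close>
  define T where "T = (SIGMA j:{..<m}. (({..<m} - {j}) \<rightarrow>\<^sub>E E) \<times> ?P)"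
  have nb: "finite (nb y)" for y using fin by (simp add: nb_def)
  have finP: "finite ?P" using card_pos_solutions(1)[of k] k by simp
  have finT: "finite T"
    unfolding T_def using fin finP
    by (intro finite_SigmaI finite_cartesian_product finite_PiE finite_lessThan finite_Diff)
  have mem: "e i \<in> E" "e i + y \<in> ?P" if "(y, e) \<in> \<Theta>" "i < m" for y e i
    using that S by (auto simp: \<Theta>_def nb_def dest: PiE_mem)
  have cross: "e (pv e) + y' \<in> ?P"
    if "\<And>i. i < m \<Longrightarrow> i \<noteq> pv e \<Longrightarrow> e i + y' \<in> ?P" for e y'
  proof -
    have p: "piv e (pv e)" by (rule pv)
    have "0 < (e (pv e) + y') $ c" for c
    proof -
      from p obtain i where i: "i < m" "i \<noteq> pv e" "e i $ c \<le> e (pv e) $ c"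
        unfolding piv_def by blast
      have "0 < (e i + y') $ c" using that[OF i(1,2)] by (auto simp: pos_solutions_def)
      with i show ?thesis by simp
    qed
    moreover have "(\<Sum>c\<in>UNIV. ((e (pv e) + y') $ c) ^ k) = int N"
      using p that unfolding piv_def pos_solutions_def by blast
    ultimately show ?thesis by (simp add: pos_solutions_def)
  qed
  have inj: "inj_on \<psi> \<Theta>"
  proof (rule inj_onI, clarify)
    fix y e y' e'
    assume 1: "(y, e) \<in> \<Theta>" and 2: "(y', e') \<in> \<Theta>" and eq: "\<psi> (y, e) = \<psi> (y', e')"
    define j where "j = pv e"
    have j: "j < m" using pv[of e] by (simp add: piv_def j_def)
    have j': "pv e' = j" and x: "e j + y = e' j + y'"
      and r: "restrict e ({..<m} - {j}) = restrict e' ({..<m} - {j})"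
      using eq by (auto simp: \<psi>_def j_def)
    have rest: "e i = e' i" if "i < m" "i \<noteq> j" for i
      using fun_cong[OF r, of i] that by (simp add: restrict_def)
    \<comment> \<open>The pivot property holds for every shift, so the centres may be exchanged.
      Both cross sums are solutions, and their midpoint is the common sum \<open>e j + y\<close>, so
      they coincide. Adding the two resulting equations gives \<open>e j = e' j\<close>
      coordinatewise.\<close>
    have "e j + y' \<in> ?P"
      unfolding j_def by (rule cross) (metis mem(2)[OF 2] rest j_def)
    moreover have "e' j + y \<in> ?P"
      using cross[of e' y] unfolding j' by (metis mem(2)[OF 1] rest)
    moreover have "(e j + y') + (e' j + y) = (e j + y) + (e j + y)"
      using x by (simp add: algebra_simps)
    ultimately have mid: "e j + y' = e' j + y"
      using pos_solutions_midpoint_eq[OF k] mem(2)[OF 1 j] by blast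
    have "e j $ c = e' j $ c" for c
      using arg_cong[OF x, of "\<lambda>v. v $ c"] arg_cong[OF mid, of "\<lambda>v. v $ c"] by simp
    then have "e j = e' j" by (simp add: vec_eq_iff)
    moreover from this have "y = y'" using x by simp
    moreover have "e = e'"
    proof (rule PiE_ext)
      show "e \<in> {..<m} \<rightarrow>\<^sub>E E" "e' \<in> {..<m} \<rightarrow>\<^sub>E E"
        using 1 2 by (auto simp: \<Theta>_def nb_def PiE_iff)
      show "e i = e' i" if "i \<in> {..<m}" for i
        using rest[of i] that \<open>e j = e' j\<close> by (cases "i = j") auto
    qed
    ultimately show "y = y' \<and> e = e'" by simp
  qed
  have sub: "\<psi> ` \<Theta> \<subseteq> T"
  proof (rule image_subsetI, clarify)
    fix y e assume 1: "(y, e) \<in> \<Theta>"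
    have "pv e < m" using pv[of e] by (simp add: piv_def)
    then show "\<psi> (y, e) \<in> T"
      using mem[OF 1] by (auto simp: \<psi>_def T_def)
  qed
  have "card \<Theta> \<le> card T" by (rule card_inj_on_le[OF inj sub finT])
  also have "card T = m * (card E ^ (m - 1) * card ?P)"
    unfolding T_def using fin finP
    by (subst card_SigmaI) (auto simp: card_cartesian_product card_PiE finite_PiE)
  finally have 1: "card \<Theta> \<le> m * (card E ^ (m - 1) * card ?P)" .
  have 2: "card \<Theta> = (\<Sum>y\<in>F. card (nb y) ^ m)"
    unfolding \<Theta>_def using fin nb by (subst card_SigmaI) (auto simp: card_PiE finite_PiE)
  have "card {(x, y). x \<in> E \<and> y \<in> F \<and> x + y \<in> S} = card (SIGMA y:F. nb y)"
    by (rule bij_betw_same_card[of prod.swap], rule bij_betwI[where g = prod.swap])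
       (auto simp: nb_def)
  also have "\<dots> = (\<Sum>y\<in>F. card (nb y))" using fin nb by (subst card_SigmaI) auto
  finally have 3: "card {(x, y). x \<in> E \<and> y \<in> F \<and> x + y \<in> S} = (\<Sum>y\<in>F. card (nb y))" .
  have "Suc (m - 1) = m" using m by simp
  then have "real (\<Sum>y\<in>F. card (nb y)) ^ m
      \<le> real (card F) ^ (m - 1) * (\<Sum>y\<in>F. real (card (nb y)) ^ m)"
    using power_sum_le_sum_power[OF fin(2), of "\<lambda>y. real (card (nb y))" "m - 1"] by simp
  also have "(\<Sum>y\<in>F. real (card (nb y)) ^ m) = real (card \<Theta>)" unfolding 2 by simp
  also have "real (card F) ^ (m - 1) * real (card \<Theta>)
      \<le> real (card F) ^ (m - 1) * real (m * (card E ^ (m - 1) * card ?P))"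
    using 1 by (intro mult_left_mono) (simp_all only: of_nat_le_iff zero_le_power of_nat_0_le_iff)
  finally show ?thesis unfolding 3 by (simp add: power_mult_distrib mult_ac)
qed

section \<open>The bilinear form off and on the critical range\<close>

text \<open>For \<open>M = 1\<close> this is the interpolation of the two trivial bounds; a gain is
  available unless both factors are near 1. If the product is at least \<open>M\<close>, then
  \<open>p > 1\<close> makes \<open>a powr p * b powr p\<close> win. If it is at most
  \<open>1 / M\<close>, then \<open>p < 2\<close> and the arithmetic-geometric mean inequality make
  \<open>a powr p + b powr p\<close> win. In between, a factor below \<open>M powr - 3\<close>
  forces the other above \<open>M powr 2\<close>, and the \<open>p\<close>-th power of a factor that
  large already dominates.\<close>

lemma product_le_powers:
  fixes a b M p \<eta> :: real
  assumes a: "0 \<le> a" and b: "0 \<le> b" and M: "1 \<le> M" and p: "1 < p" "p < 2"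
    and \<eta>: "\<eta> \<le> p - 1" "\<eta> \<le> 1 - p / 2"
    and out: "\<not> (M powr - 3 \<le> a \<and> a \<le> M powr 2 \<and> M powr - 3 \<le> b \<and> b \<le> M powr 2)"
  shows "a * b \<le> M powr - \<eta> * (a powr p + b powr p + a powr p * b powr p)"
proof (cases "a = 0 \<or> b = 0")
  case True
  then show ?thesis by auto
next
  case False
  then have pos: "0 < a" "0 < b" using a b by auto
  have mono: "M powr s \<le> M powr t" if "s \<le> t" for s t
    using that M by (rule powr_mono)
  have large: "x * y \<le> M powr - \<eta> * x powr p" if "M powr 2 < x" "x * y \<le> M" for x y
  proof -
    have "M = M powr - \<eta> * M powr (1 + \<eta>)"
      using M by (simp flip: powr_add)
    also have "M powr (1 + \<eta>) \<le> M powr (2 * p)"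
      using \<eta> p by (intro mono) linarith
    also have "M powr (2 * p) = (M powr 2) powr p" by (simp add: powr_powr)
    also have "\<dots> \<le> x powr p" using that p by (intro powr_mono2) auto
    finally show ?thesis using that(2) by (simp add: mult_left_mono)
  qed
  consider "M \<le> a * b" | "a * b \<le> M powr - 1" | "M powr - 1 < a * b" "a * b < M" by linarith
  then show ?thesis
  proof cases
    case 1
    have "a * b = (a * b) powr (1 - p) * (a * b) powr p"
      using pos by (simp flip: powr_add)
    also have "(a * b) powr (1 - p) \<le> M powr (1 - p)"
      using 1 M p by (intro powr_mono2') auto
    also have "\<dots> \<le> M powr - \<eta>" using \<eta> by (intro mono) linarith
    finally have "a * b \<le> M powr - \<eta> * (a powr p * b powr p)"
      using pos by (simp add: powr_mult mult_right_mono)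
    also have "\<dots> \<le> M powr - \<eta> * (a powr p + b powr p + a powr p * b powr p)"
      by (intro mult_left_mono) auto
    finally show ?thesis .
  next
    case 2
    have "0 \<le> (a powr (p / 2) - b powr (p / 2))\<^sup>2" by simp
    then have "2 * (a powr (p / 2) * b powr (p / 2)) \<le> a powr (p / 2) * a powr (p / 2) + b powr (p / 2) * b powr (p / 2)"
      by (simp add: power2_eq_square algebra_simps)
    moreover have "0 \<le> a powr (p / 2) * b powr (p / 2)" by simp
    moreover have "x powr (p / 2) * x powr (p / 2) = x powr p" for x by (simp flip: powr_add)
    ultimately have amgm: "a powr (p / 2) * b powr (p / 2) \<le> a powr p + b powr p"
      by (smt (verit))
    have "a * b = (a * b) powr (1 - p / 2) * (a * b) powr (p / 2)"
      using pos by (simp flip: powr_add)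
    also have "(a * b) powr (1 - p / 2) \<le> (M powr - 1) powr (1 - p / 2)"
      using 2 pos p by (intro powr_mono2) auto
    also have "(M powr - 1) powr (1 - p / 2) = M powr (- 1 * (1 - p / 2))" by (rule powr_powr)
    also have "\<dots> \<le> M powr - \<eta>" using \<eta> by (intro mono) simp
    also have "(a * b) powr (p / 2) = a powr (p / 2) * b powr (p / 2)"
      using pos by (simp add: powr_mult)
    also note amgm
    finally have "a * b \<le> M powr - \<eta> * (a powr p + b powr p)"
      by (simp add: mult_right_mono mult_left_mono)
    also have "\<dots> \<le> M powr - \<eta> * (a powr p + b powr p + a powr p * b powr p)"
      by (intro mult_left_mono) auto
    finally show ?thesis .
  next
    case 3
    have small: "M powr 2 < y" if "0 < x" "x < M powr - 3" "M powr - 1 < x * y" for x y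
    proof -
      have "0 < M powr - 1" using M by simp
      then have "0 < y" using that by (metis less_trans zero_less_mult_pos)
      have "M powr 2 * M powr - 3 = M powr - 1" by (simp flip: powr_add)
      also have "\<dots> < x * y" by fact
      also have "\<dots> < M powr - 3 * y" using that \<open>0 < y\<close> by simp
      finally show ?thesis using M by (simp add: mult.commute)
    qed
    have "M powr 2 < a \<or> M powr 2 < b"
      using out small[of a b] small[of b a] pos 3 by (auto simp: not_le mult.commute)
    then show ?thesis
    proof
      assume "M powr 2 < a"
      with large[of a b] 3 have "a * b \<le> M powr - \<eta> * a powr p" by simp
      also have "\<dots> \<le> M powr - \<eta> * (a powr p + b powr p + a powr p * b powr p)"
        by (intro mult_left_mono) auto
      finally show ?thesis .
    next
      assume "M powr 2 < b"
      with large[of b a] 3 have "a * b \<le> M powr - \<eta> * b powr p" by (simp add: mult.commute)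
      also have "\<dots> \<le> M powr - \<eta> * (a powr p + b powr p + a powr p * b powr p)"
        by (intro mult_left_mono) auto
      finally show ?thesis .
    qed
  qed
qed

text \<open>Off the critical range the pointwise inequality is summed: the terms in
  \<open>a powr p\<close> and \<open>b powr p\<close> use that \<open>K\<close> has mass at most 1,
  the product term uses \<open>K\<close> at most \<open>\<kappa>\<close>. On the critical range each
  summand is at most \<open>\<kappa> * M powr 4\<close> and only incidences contribute.\<close>

lemma bilinear_form_split:
  fixes K :: "'v::ab_group_add \<Rightarrow> real" and a b :: "'v \<Rightarrow> real"
  assumes fin: "finite X" "finite Y"
    and K: "\<And>z. 0 \<le> K z" "\<And>z. K z \<le> \<kappa>" "\<And>z. z \<notin> S \<Longrightarrow> K z = 0"
    and K1: "\<And>Z. finite Z \<Longrightarrow> sum K Z \<le> 1"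
    and a: "\<And>x. 0 \<le> a x" "(\<Sum>x\<in>X. a x powr p) \<le> D"
    and b: "\<And>y. 0 \<le> b y" "(\<Sum>y\<in>Y. b y powr p) \<le> D"
    and M: "1 \<le> M" and p: "1 < p" "p < 2" and \<eta>: "\<eta> \<le> p - 1" "\<eta> \<le> 1 - p / 2"
  shows "(\<Sum>x\<in>X. \<Sum>y\<in>Y. K (x + y) * (a x * b y))
    \<le> M powr - \<eta> * (2 * D + \<kappa> * D\<^sup>2) + \<kappa> * M powr 4 *
      real (card {(x, y). x \<in> {x\<in>X. M powr - 3 \<le> a x} \<and> y \<in> {y\<in>Y. M powr - 3 \<le> b y} \<and> x + y \<in> S})"
proof -
  define E where "E = {x\<in>X. M powr - 3 \<le> a x}"
  define F where "F = {y\<in>Y. M powr - 3 \<le> b y}"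
  define I where "I = {(x, y). x \<in> E \<and> y \<in> F \<and> x + y \<in> S}"
  have \<kappa>: "0 \<le> \<kappa>" using K(1,2)[of 0] by linarith
  have D: "0 \<le> D" using a(2) sum_nonneg[of X "\<lambda>x. a x powr p"] by force
  have pt: "K (x + y) * (a x * b y) \<le> M powr - \<eta> * (K (x + y) * a x powr p + K (x + y) * b y powr p
      + \<kappa> * (a x powr p * b y powr p)) + \<kappa> * M powr 4 * (if (x, y) \<in> I then 1 else 0)"
    if xy: "x \<in> X" "y \<in> Y" for x y
  proof (cases "x + y \<in> S")
    case False
    then show ?thesis using K(3) \<kappa> by simp
  next
    case S: True
    have nn: "0 \<le> M powr - \<eta> * (K (x + y) * a x powr p + K (x + y) * b y powr p
      + \<kappa> * (a x powr p * b y powr p))"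
      using K(1) \<kappa> by (intro mult_nonneg_nonneg add_nonneg_nonneg) auto
    show ?thesis
    proof (cases "M powr - 3 \<le> a x \<and> a x \<le> M powr 2 \<and> M powr - 3 \<le> b y \<and> b y \<le> M powr 2")
      case True
      then have "(x, y) \<in> I" using S xy by (auto simp: I_def E_def F_def)
      have "K (x + y) * (a x * b y) \<le> \<kappa> * (M powr 2 * M powr 2)"
        using True K \<kappa> a b by (intro mult_mono) auto
      also have "M powr 2 * M powr 2 = M powr 4" by (simp flip: powr_add)
      finally show ?thesis using nn \<open>(x, y) \<in> I\<close> by simp
    next
      case False
      have "K (x + y) * (a x * b y)
          \<le> K (x + y) * (M powr - \<eta> * (a x powr p + b y powr p + a x powr p * b y powr p))"
        using K(1) by (intro mult_left_mono product_le_powers a b M p \<eta> False)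
      also have "\<dots> = M powr - \<eta> * (K (x + y) * a x powr p + K (x + y) * b y powr p
          + K (x + y) * (a x powr p * b y powr p))"
        by (simp add: algebra_simps)
      also have "\<dots> \<le> M powr - \<eta> * (K (x + y) * a x powr p + K (x + y) * b y powr p
          + \<kappa> * (a x powr p * b y powr p))"
        using K(2) by (intro mult_left_mono add_left_mono mult_right_mono) auto
      also have "\<dots> \<le> \<dots> + \<kappa> * M powr 4 * (if (x, y) \<in> I then 1 else 0)"
        using \<kappa> by simp
      finally show ?thesis .
    qed
  qed
  \<comment> \<open>Schur's test: every translate of \<open>K\<close> has mass at most 1, and by
    symmetry of \<open>x + y\<close> this serves rows and columns alike.\<close>
  have row: "(\<Sum>y\<in>Y. K (x + y)) \<le> 1" if "finite Y" for x Y
  proof -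
    have "(\<Sum>y\<in>Y. K (x + y)) = sum K ((+) x ` Y)"
      by (subst sum.reindex) (auto simp: inj_on_def)
    also have "\<dots> \<le> 1" using that by (intro K1) auto
    finally show ?thesis .
  qed
  have A: "(\<Sum>x\<in>X. \<Sum>y\<in>Y. K (x + y) * a x powr p) \<le> D"
  proof -
    have "(\<Sum>x\<in>X. \<Sum>y\<in>Y. K (x + y) * a x powr p) \<le> (\<Sum>x\<in>X. 1 * a x powr p)"
      unfolding sum_distrib_right[symmetric] using row[OF fin(2)]
      by (intro sum_mono mult_right_mono) auto
    then show ?thesis using a by simp
  qed
  have B: "(\<Sum>x\<in>X. \<Sum>y\<in>Y. K (x + y) * b y powr p) \<le> D"
  proof -
    have "(\<Sum>x\<in>X. \<Sum>y\<in>Y. K (x + y) * b y powr p) = (\<Sum>y\<in>Y. \<Sum>x\<in>X. K (y + x) * b y powr p)"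
      by (subst sum.swap) (simp add: add.commute)
    also have "\<dots> \<le> (\<Sum>y\<in>Y. 1 * b y powr p)"
      unfolding sum_distrib_right[symmetric] using row[OF fin(1)]
      by (intro sum_mono mult_right_mono) auto
    finally show ?thesis using b by simp
  qed
  have C: "(\<Sum>x\<in>X. \<Sum>y\<in>Y. \<kappa> * (a x powr p * b y powr p)) \<le> \<kappa> * D\<^sup>2"
  proof -
    have "(\<Sum>x\<in>X. \<Sum>y\<in>Y. \<kappa> * (a x powr p * b y powr p))
        = \<kappa> * ((\<Sum>x\<in>X. a x powr p) * (\<Sum>y\<in>Y. b y powr p))"
      unfolding sum_product by (simp add: sum_distrib_left)
    also have "\<dots> \<le> \<kappa> * (D * D)"
      using a b \<kappa> D by (intro mult_left_mono mult_mono sum_nonneg) auto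
    finally show ?thesis by (simp add: power2_eq_square)
  qed
  have finI: "finite (X \<times> Y)" "I \<subseteq> X \<times> Y" using fin by (auto simp: I_def E_def F_def)
  have I: "(\<Sum>x\<in>X. \<Sum>y\<in>Y. if (x, y) \<in> I then 1 else 0) = real (card I)"
  proof -
    have "(\<Sum>x\<in>X. \<Sum>y\<in>Y. if (x, y) \<in> I then 1 else 0) = (\<Sum>z\<in>X \<times> Y. if z \<in> I then 1 else (0::real))"
      by (simp add: sum.cartesian_product case_prod_unfold)
    also have "\<dots> = real (card I)"
      using finI by (simp add: sum.If_cases Int_absorb2 Int_commute)
    finally show ?thesis .
  qed
  have "(\<Sum>x\<in>X. \<Sum>y\<in>Y. K (x + y) * (a x * b y)) \<le>
    (\<Sum>x\<in>X. \<Sum>y\<in>Y. M powr - \<eta> * (K (x + y) * a x powr p + K (x + y) * b y powr p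
      + \<kappa> * (a x powr p * b y powr p)) + \<kappa> * M powr 4 * (if (x, y) \<in> I then 1 else 0))"
    by (intro sum_mono pt)
  also have "\<dots> = M powr - \<eta> * ((\<Sum>x\<in>X. \<Sum>y\<in>Y. K (x + y) * a x powr p)
      + (\<Sum>x\<in>X. \<Sum>y\<in>Y. K (x + y) * b y powr p)
      + (\<Sum>x\<in>X. \<Sum>y\<in>Y. \<kappa> * (a x powr p * b y powr p)))
      + \<kappa> * M powr 4 * (\<Sum>x\<in>X. \<Sum>y\<in>Y. if (x, y) \<in> I then 1 else 0)"
    unfolding sum.distrib sum_distrib_left[symmetric] ..
  also have "\<dots> \<le> M powr - \<eta> * (D + D + \<kappa> * D\<^sup>2) + \<kappa> * M powr 4 * real (card I)"
    unfolding I using \<kappa> by (intro add_mono mult_left_mono A B C) auto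
  finally show ?thesis by (simp add: I_def E_def F_def)
qed

section \<open>From bilinear bounds to operator norms by duality\<close>

text \<open>Duality with the extremal test function \<open>h powr (p' - 1)\<close>. The bilinear
  bound is assumed only at the normalisation \<open>D\<close>, since its proof is not homogeneous,
  so both functions are rescaled to \<open>p\<close>-mass at most \<open>D\<close>; undoing this
  produces the factor \<open>D powr (1 - 2 / p)\<close>. Finite sets \<open>Y\<close> are treated
  first, and the summability of \<open>g\<close> comes out as a conclusion.\<close>

lemma lp_improving_of_bilinear:
  fixes f g :: "'v::ab_group_add \<Rightarrow> complex" and K :: "'v \<Rightarrow> real"
  assumes p: "1 < p" and p': "1 / p + 1 / p' = 1" and D: "0 < D"
    and S: "finite S" and K: "\<And>z. 0 \<le> K z"
    and bil: "\<And>X Y a b. finite X \<Longrightarrow> finite Y \<Longrightarrow> (\<And>x. 0 \<le> a x) \<Longrightarrow> (\<And>y. 0 \<le> b y) \<Longrightarrow>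
      (\<Sum>x\<in>X. a x powr p) \<le> D \<Longrightarrow> (\<Sum>y\<in>Y. b y powr p) \<le> D \<Longrightarrow>
      (\<Sum>x\<in>X. \<Sum>y\<in>Y. K (x + y) * (a x * b y)) \<le> D * W"
    and f: "in_lp p f" and g: "\<And>l. norm (g l) \<le> (\<Sum>v\<in>S. K v * norm (f (v - l)))"
  shows "in_lp p' g \<and> lp_norm p' g \<le> D powr (1 - 2 / p) * W * lp_norm p f"
proof -
  define A where "A = (\<Sum>\<^sub>\<infinity>x. norm (f x) powr p)"
  define h where "h l = (\<Sum>v\<in>S. K v * norm (f (v - l)))" for l
  define R where "R = D powr (1 - 2 / p) * W * A powr (1 / p)"
  have h0: "0 \<le> h l" for l unfolding h_def using K by (intro sum_nonneg mult_nonneg_nonneg) auto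
  have W: "0 \<le> W" using bil[of "{}" "{}" "\<lambda>_. 0" "\<lambda>_. 0"] D by (simp add: zero_le_mult_iff)
  have R0: "0 \<le> R" using W by (simp add: R_def)
  have q: "1 / p' = 1 - 1 / p" using p' by simp
  then have "0 < 1 / p'" using p by simp
  then have p'0: "0 < p'" by simp
  \<comment> \<open>This makes the \<open>p\<close>-mass of the test function a multiple of the
    \<open>p'\<close>-mass of \<open>h\<close>.\<close>
  have pp: "(p' - 1) * p = p'" using p' p p'0 by (simp add: field_simps)
  have fs: "(\<lambda>x. norm (f x) powr p) summable_on UNIV" using f by (simp add: in_lp_def)
  have A0: "0 \<le> A" unfolding A_def by (rule infsum_nonneg) simp
  have fX: "(\<Sum>x\<in>X. norm (f x) powr p) \<le> A" if "finite X" for X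
    unfolding A_def using fs that by (intro finite_sum_le_infsum) auto
  have main: "(\<Sum>l\<in>Y. h l powr p') \<le> R powr p'" if Y: "finite Y" for Y
  proof -
    define H where "H = (\<Sum>l\<in>Y. h l powr p')"
    have H0: "0 \<le> H" unfolding H_def by (intro sum_nonneg) simp
    show ?thesis
    proof (cases "H = 0 \<or> A = 0")
      case True
      \<comment> \<open>The rescaling divides by \<open>A\<close> and \<open>H\<close>. A vanishing
        \<open>A\<close> forces \<open>f\<close> and hence \<open>h\<close> to vanish.\<close>
      have "H = 0" if "A = 0"
      proof -
        have "norm (f x) powr p \<le> 0" for x using fX[of "{x}"] that by simp
        then have "norm (f x) powr p = 0" for x by (simp add: order_antisym)
        then have "f x = 0" for x by simp
        then show ?thesis by (simp add: H_def h_def)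
      qed
      with True show ?thesis using H_def by auto
    next
      case False
      then have pos: "0 < H" "0 < A" using H0 A0 by auto
      define X where "X = (\<Union>l\<in>Y. (\<lambda>v. v - l) ` S)"
      have X: "finite X" using Y S by (auto simp: X_def)
      define a where "a x = (D / A) powr (1 / p) * norm (f x)" for x
      define b where "b l = (D / H) powr (1 / p) * h l powr (p' - 1)" for l
      have "(\<Sum>x\<in>X. a x powr p) = D / A * (\<Sum>x\<in>X. norm (f x) powr p)"
        unfolding a_def using D pos p
        by (simp add: powr_mult powr_powr sum_distrib_left)
      also have "\<dots> \<le> D / A * A" using D pos fX[OF X] by (intro mult_left_mono) auto
      finally have Sa: "(\<Sum>x\<in>X. a x powr p) \<le> D" using pos by simp
      have "(\<Sum>l\<in>Y. b l powr p) = D / H * H"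
        unfolding b_def using D pos p
        by (simp add: powr_mult powr_powr sum_distrib_left pp H_def)
      then have Sb: "(\<Sum>l\<in>Y. b l powr p) \<le> D" using pos by simp
      have inner: "h l \<le> (\<Sum>x\<in>X. K (x + l) * norm (f x))" if "l \<in> Y" for l
      proof -
        have "h l = (\<Sum>x\<in>(\<lambda>v. v - l) ` S. K (x + l) * norm (f x))"
          unfolding h_def by (subst sum.reindex) (auto simp: inj_on_def)
        also have "\<dots> \<le> (\<Sum>x\<in>X. K (x + l) * norm (f x))"
          using X K that by (intro sum_mono2) (auto simp: X_def)
        finally show ?thesis .
      qed
      let ?c = "(D / A) powr (1 / p) * (D / H) powr (1 / p)"
      have "?c * H = ?c * (\<Sum>l\<in>Y. h l powr (p' - 1) * h l)"
      proof -
        have "h l powr p' = h l powr (p' - 1) * h l" for l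
          using h0[of l] by (cases "h l = 0") (auto simp: powr_diff)
        then show ?thesis by (simp add: H_def)
      qed
      also have "\<dots> \<le> ?c * (\<Sum>l\<in>Y. h l powr (p' - 1) * (\<Sum>x\<in>X. K (x + l) * norm (f x)))"
        by (intro mult_left_mono sum_mono inner) auto
      also have "\<dots> = (\<Sum>l\<in>Y. \<Sum>x\<in>X. K (x + l) * (a x * b l))"
        by (simp add: a_def b_def sum_distrib_left mult_ac)
      also have "\<dots> = (\<Sum>x\<in>X. \<Sum>l\<in>Y. K (x + l) * (a x * b l))" by (rule sum.swap)
      also have "\<dots> \<le> D * W"
        by (rule bil[OF X Y _ _ Sa Sb]) (auto simp: a_def b_def)
      finally have *: "?c * H \<le> D * W" .
      have cH: "?c * H = D powr (2 / p) * H powr (1 / p') / A powr (1 / p)"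
      proof -
        have "H powr (1 / p') = H / H powr (1 / p)"
          unfolding q using pos by (simp add: powr_diff)
        moreover have "D powr (2 / p) = D powr (1 / p) * D powr (1 / p)" by (simp flip: powr_add)
        ultimately show ?thesis using pos D by (simp add: powr_divide)
      qed
      have "H powr (1 / p') \<le> R"
      proof -
        have "D powr (2 / p) * H powr (1 / p') \<le> D * W * A powr (1 / p)"
          using * pos unfolding cH by (simp add: pos_divide_le_eq)
        then have "H powr (1 / p') \<le> D * W * A powr (1 / p) / D powr (2 / p)"
          using D by (simp add: pos_le_divide_eq mult.commute)
        also have "\<dots> = R" using D by (simp add: R_def powr_diff)
        finally show ?thesis .
      qed
      then have "(H powr (1 / p')) powr p' \<le> R powr p'"
        using p'0 by (intro powr_mono2) auto
      then show ?thesis using pos p'0 by (simp add: powr_powr H_def)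
    qed
  qed
  have gY: "(\<Sum>l\<in>Y. norm (g l) powr p') \<le> R powr p'" if "finite Y" for Y
  proof -
    have "(\<Sum>l\<in>Y. norm (g l) powr p') \<le> (\<Sum>l\<in>Y. h l powr p')"
      using g p'0 by (intro sum_mono powr_mono2) (auto simp: h_def)
    also have "\<dots> \<le> R powr p'" by (rule main) fact
    finally show ?thesis .
  qed
  have gs: "(\<lambda>l. norm (g l) powr p') summable_on UNIV"
    using gY by (intro nonneg_bdd_above_summable_on bdd_aboveI2[where M = "R powr p'"]) auto
  have "(\<Sum>\<^sub>\<infinity>l. norm (g l) powr p') \<le> R powr p'"
    by (rule infsum_le_finite_sums[OF gs]) (use gY in auto)
  then have "lp_norm p' g \<le> (R powr p') powr (1 / p')"
    unfolding lp_norm_def using p'0 by (intro powr_mono2 infsum_nonneg) auto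
  also have "\<dots> = R" using p'0 R0 by (simp add: powr_powr)
  finally show ?thesis using gs by (simp add: in_lp_def R_def lp_norm_def A_def)
qed

section \<open>Saving a power of N\<close>

text \<open>The incidence count needs n > 2k. For \<open>k\<close> at least 5, each quotient in the
  maximum has numerator at most \<open>k * (k - 1)\<close> and denominator at least 2.\<close>

lemma threshold_ge:
  assumes "2 \<le> k"
  shows "2 * int k + 1 \<le> n\<^sub>0 k"
proof (cases "k \<le> 4")
  case True
  then have "k = 2 \<or> k = 3 \<or> k = 4" using assms by auto
  then show ?thesis by (auto simp: n\<^sub>0_def)
next
  case False
  \<comment> \<open>The value for which \<open>k ^ 2 + 3 - c\<close> equals
    \<open>2 * k + 1\<close>.\<close>
  define c where "c = int k ^ 2 + 2 - 2 * int k"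
  have "0 \<le> (real k - 1)\<^sup>2 + 1" by simp
  then have c0: "0 \<le> real_of_int c" by (simp add: c_def power2_eq_square algebra_simps)
  have "0 \<le> (real k - 3) * real k" using False by simp
  then have c2: "real k * (real k - 1) \<le> 2 * real_of_int c"
    by (simp add: c_def power2_eq_square algebra_simps)
  have "\<lceil>(real k * real j - min (2 ^ j) (real j ^ 2 + real j)) / (real k - real j + 1)\<rceil> \<le> c"
    if j: "j \<in> {1..k - 1}" for j
  proof -
    have j': "real j \<le> real k - 1" "2 \<le> real k - real j + 1" using j False by auto
    have "real k * real j - min (2 ^ j) (real j ^ 2 + real j) \<le> real k * real j"
      by simp
    also have "\<dots> \<le> real k * (real k - 1)" using j' by (intro mult_left_mono) auto
    also note c2
    also have "2 * real_of_int c \<le> (real k - real j + 1) * real_of_int c"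
      using j' c0 by (intro mult_right_mono) auto
    finally show ?thesis
      using j' by (intro ceiling_le) (simp add: pos_divide_le_eq mult.commute)
  qed
  then have "Max ((\<lambda>j. \<lceil>(real k * real j - min (2 ^ j) (real j ^ 2 + real j)) / (real k - real j + 1)\<rceil>)
             ` {1..k - 1}) \<le> c" (is "?Max \<le> c")
    using False by (intro Max.boundedI) auto
  moreover have "n\<^sub>0 k = int k ^ 2 + 3 - ?Max"
    using False by (simp only: n\<^sub>0_def if_False)
  ultimately show ?thesis by (simp add: c_def)
qed

text \<open>The trivial bound is \<open>card E * card F\<close>, at most
  \<open>D\<^sup>2 * M powr 12\<close>. Since n is at least 2k + 1, even the crude size
  \<open>N powr (n / k)\<close> of the solution set is at most
  \<open>D\<^sup>2 * N powr (- 1 / k)\<close>, and the \<open>m\<close>-th root of that gain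
  survives.\<close>

lemma incidence_power_saving:
  fixes E F S :: "(int ^ 'n::finite) set" and N :: nat
  assumes k: "2 \<le> k" and m: "m = CARD('n) * (k + 2) + 1" and n: "2 * k + 1 \<le> CARD('n)"
    and N: "1 \<le> N" and D: "D = real N powr (real CARD('n) / real k - 1)" and M: "1 \<le> M"
    and fin: "finite E" "finite F" and S: "S \<subseteq> pos_solutions k N"
    and E: "real (card E) \<le> D * M powr 6" and F: "real (card F) \<le> D * M powr 6"
  shows "real (card {(x, y). x \<in> E \<and> y \<in> F \<and> x + y \<in> S})
    \<le> real m * D\<^sup>2 * M powr 12 * real N powr (- 1 / (real k * real m))"
proof -
  define I where "I = real (card {(x, y). x \<in> E \<and> y \<in> F \<and> x + y \<in> S})"
  define B where "B = D\<^sup>2 * M powr 12"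
  define P where "P = real (card (pos_solutions k N :: (int ^ 'n) set))"
  have m0: "0 < m" "Suc (m - 1) = m" using m by auto
  have D0: "0 < D" using N by (simp add: D)
  have B0: "0 < B" using D0 M by (simp add: B_def)
  have EF: "real (card E) * real (card F) \<le> B"
  proof -
    have "real (card E) * real (card F) \<le> (D * M powr 6) * (D * M powr 6)"
      using E F D0 by (intro mult_mono) auto
    also have "\<dots> = D\<^sup>2 * (M powr 6 * M powr 6)" by (simp add: power2_eq_square)
    also have "M powr 6 * M powr 6 = M powr 12" by (simp flip: powr_add)
    finally show ?thesis by (simp add: B_def)
  qed
  have D2: "real N powr (2 * (real CARD('n) / real k - 1)) = D\<^sup>2"
    unfolding D by (subst powr_power) (use N in \<open>auto simp: mult.commute\<close>)
  have PB: "P \<le> B * real N powr (- 1 / real k)"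
  proof -
    have "P \<le> real N powr (real CARD('n) / real k)"
      unfolding P_def using k by (intro card_pos_solutions) auto
    also have "\<dots> \<le> real N powr (2 * (real CARD('n) / real k - 1) + - 1 / real k)"
    proof (intro powr_mono)
      have "2 * real k + 1 \<le> real CARD('n)" using n by linarith
      then have "(2 * real k + 1) / real k \<le> real CARD('n) / real k"
        by (intro divide_right_mono) auto
      then show "real CARD('n) / real k \<le> 2 * (real CARD('n) / real k - 1) + - 1 / real k"
        using k by (simp add: add_divide_distrib)
    qed (use N in simp)
    also have "\<dots> = D\<^sup>2 * 1 * real N powr (- 1 / real k)"
      by (simp only: powr_add D2 mult_1_right)
    also have "\<dots> \<le> B * real N powr (- 1 / real k)"
      unfolding B_def using M by (intro mult_right_mono mult_left_mono) (auto simp: ge_one_powr_ge_zero)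
    finally show ?thesis .
  qed
  have "I ^ m \<le> real m * (real (card E) * real (card F)) ^ (m - 1) * P"
    unfolding I_def P_def by (rule incidence_bound[OF k m fin S])
  also have "\<dots> \<le> real m * B ^ (m - 1) * (B * real N powr (- 1 / real k))"
    using EF PB B0 by (intro mult_mono power_mono) (auto simp: P_def)
  also have "\<dots> = real m * (B ^ Suc (m - 1) * real N powr (- 1 / real k))" by simp
  also have "\<dots> = real m ^ 1 * (B ^ m * real N powr (- 1 / real k))" by (simp only: m0 power_one_right)
  \<comment> \<open>Enlarging the constant turns the whole right-hand side into an
    \<open>m\<close>-th power.\<close>
  also have "\<dots> \<le> real m ^ m * (B ^ m * real N powr (- 1 / real k))"
    using m0 B0 by (intro mult_right_mono power_increasing) auto
  also have "real N powr (- 1 / real k) = (real N powr (- 1 / (real k * real m))) ^ m"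
    using m0 N by (simp add: powr_power)
  finally have "I ^ m \<le> (real m * B * real N powr (- 1 / (real k * real m))) ^ m"
    by (simp add: power_mult_distrib)
  then have "I \<le> real m * B * real N powr (- 1 / (real k * real m))"
    using m0 B0 by (subst (asm) power_mono_iff) (auto simp: I_def)
  then show ?thesis by (simp add: I_def B_def mult.assoc)
qed

lemma card_superlevel_le:
  fixes a :: "'v \<Rightarrow> real"
  assumes "finite X" "(\<Sum>x\<in>X. a x powr p) \<le> D" "0 < p" "0 < t"
  shows "real (card {x\<in>X. t \<le> a x}) \<le> D * t powr - p"
proof -
  have "real (card {x\<in>X. t \<le> a x}) * t powr p = (\<Sum>x | x \<in> X \<and> t \<le> a x. t powr p)" by simp
  also have "\<dots> \<le> (\<Sum>x | x \<in> X \<and> t \<le> a x. a x powr p)"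
    using assms by (intro sum_mono powr_mono2) auto
  also have "\<dots> \<le> (\<Sum>x\<in>X. a x powr p)" using assms by (intro sum_mono2) auto
  also note assms(2)
  finally show ?thesis using assms(4) by (simp add: powr_minus pos_le_divide_eq field_simps)
qed

lemma bilinear_power_saving:
  fixes K a b :: "int ^ 'n::finite \<Rightarrow> real" and N :: nat
  assumes k: "2 \<le> k" and m: "m = CARD('n) * (k + 2) + 1" and n: "2 * k + 1 \<le> CARD('n)"
    and N: "1 \<le> N" and D: "D = real N powr (real CARD('n) / real k - 1)"
    and fin: "finite X" "finite Y" and S: "S \<subseteq> pos_solutions k N"
    and K: "\<And>z. 0 \<le> K z" "\<And>z. K z \<le> \<kappa>" "\<And>z. z \<notin> S \<Longrightarrow> K z = 0"
    and K1: "\<And>Z. finite Z \<Longrightarrow> sum K Z \<le> 1"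
    and a: "\<And>x. 0 \<le> a x" "(\<Sum>x\<in>X. a x powr p) \<le> D"
    and b: "\<And>y. 0 \<le> b y" "(\<Sum>y\<in>Y. b y powr p) \<le> D"
    and p: "1 < p" "p < 2" and \<eta>: "\<eta> \<le> p - 1" "\<eta> \<le> 1 - p / 2"
  shows "(\<Sum>x\<in>X. \<Sum>y\<in>Y. K (x + y) * (a x * b y))
    \<le> D * (real N powr (- \<eta> / (32 * real k * real m)) * (2 + \<kappa> * D * (real m + 1)))"
proof -
  \<comment> \<open>The incidences gain \<open>N powr (- 32 * c)\<close>, while the sizes of the
    level sets cost \<open>M powr 12\<close> and the size of the summands \<open>M powr 4\<close>.
    With \<open>M = N powr c\<close> a gain of \<open>M powr - 16\<close> remains, better than the
    \<open>M powr - \<eta>\<close> from off the critical range.\<close>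
  define c where "c = 1 / (32 * real k * real m)"
  define M where "M = real N powr c"
  have "0 < m" unfolding m by simp
  then have km: "0 < real k" "0 < real m" using k by auto
  have c: "0 < c" using km by (simp add: c_def)
  have M: "1 \<le> M" unfolding M_def using N c by (intro ge_one_powr_ge_zero) auto
  have \<kappa>: "0 \<le> \<kappa>" using K(1,2)[of 0] by linarith
  have D0: "0 < D" using N by (simp add: D)
  \<comment> \<open>Chebyshev's inequality at height \<open>M powr - 3\<close> costs
    \<open>M powr (3 * p)\<close>, and \<open>p < 2\<close>.\<close>
  have sup: "real (card {x\<in>X. M powr - 3 \<le> a x}) \<le> D * M powr 6"
    if "finite X" "(\<Sum>x\<in>X. a x powr p) \<le> D" for X and a :: "int ^ 'n \<Rightarrow> real"
  proof -
    have "real (card {x\<in>X. M powr - 3 \<le> a x}) \<le> D * (M powr - 3) powr - p"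
      using that p M by (intro card_superlevel_le) auto
    also have "(M powr - 3) powr - p = M powr (3 * p)" by (simp add: powr_powr)
    also have "D * M powr (3 * p) \<le> D * M powr 6"
      using p M D0 by (intro mult_left_mono powr_mono) auto
    finally show ?thesis .
  qed
  define I where "I = real (card {(x, y). x \<in> {x\<in>X. M powr - 3 \<le> a x} \<and>
    y \<in> {y\<in>Y. M powr - 3 \<le> b y} \<and> x + y \<in> S})"
  have I: "I \<le> real m * D\<^sup>2 * M powr 12 * real N powr (- 1 / (real k * real m))"
    unfolding I_def using fin
    by (intro incidence_power_saving[OF k m n N D M _ _ S] sup a b) auto
  have small: "M powr 4 * (M powr 12 * real N powr (- 1 / (real k * real m))) \<le> M powr - \<eta>"
  proof -
    have "- 1 / (real k * real m) = - 32 * c" using km by (simp add: c_def)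
    then have "M powr 4 * (M powr 12 * real N powr (- 1 / (real k * real m))) = real N powr (- 16 * c)"
      by (simp add: M_def powr_powr flip: powr_add)
    also have "\<dots> \<le> real N powr (c * - \<eta>)"
    proof (rule powr_mono)
      have "\<eta> \<le> 16" using \<eta> p by linarith
      then show "- 16 * c \<le> c * - \<eta>" using c by simp
    qed (use N in simp)
    finally show ?thesis by (simp add: M_def powr_powr)
  qed
  have "(\<Sum>x\<in>X. \<Sum>y\<in>Y. K (x + y) * (a x * b y))
      \<le> M powr - \<eta> * (2 * D + \<kappa> * D\<^sup>2) + \<kappa> * M powr 4 * I"
    unfolding I_def by (rule bilinear_form_split[OF fin K K1 a b M p \<eta>])
  also have "\<kappa> * M powr 4 * I \<le> \<kappa> * M powr 4 *
      (real m * D\<^sup>2 * M powr 12 * real N powr (- 1 / (real k * real m)))"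
    using \<kappa> I by (intro mult_left_mono) auto
  also have "\<dots> = \<kappa> * real m * D\<^sup>2 *
      (M powr 4 * (M powr 12 * real N powr (- 1 / (real k * real m))))" by (simp only: ac_simps)
  also have "\<dots> \<le> \<kappa> * real m * D\<^sup>2 * M powr - \<eta>"
    using \<kappa> small by (intro mult_left_mono) auto
  finally have "(\<Sum>x\<in>X. \<Sum>y\<in>Y. K (x + y) * (a x * b y))
      \<le> D * (M powr - \<eta> * (2 + \<kappa> * D * (real m + 1)))"
    by (simp add: algebra_simps power2_eq_square)
  moreover have "M powr - \<eta> = real N powr (- \<eta> / (32 * real k * real m))"
    by (simp add: M_def powr_powr c_def)
  ultimately show ?thesis by simp
qed

section \<open>Averages over prime vectors\<close>

lemma prime_vectors_subset:
  "prime_vectors k N \<subseteq> (pos_solutions k N :: (int ^ 'n::finite) set)"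
  by (auto simp: prime_vectors_def pos_solutions_def prime_gt_0_int)

lemma log_weight_nonneg: "v \<in> prime_vectors k N \<Longrightarrow> 0 \<le> log_weight v"
  unfolding log_weight_def prime_vectors_def
  by (intro prod_nonneg) (auto intro!: ln_ge_zero dest!: spec prime_ge_1_int)

lemma log_weight_le:
  fixes v :: "int ^ 'n::finite"
  assumes v: "v \<in> prime_vectors k N" and k: "0 < k"
  shows "log_weight v \<le> ln (real N) ^ CARD('n)"
proof -
  have vi: "0 < v $ i" "v $ i \<le> int N" for i
  proof -
    have v': "v \<in> pos_solutions k N" using v prime_vectors_subset by blast
    show pos: "0 < v $ i" for i using v' by (auto simp: pos_solutions_def)
    have "v $ i \<le> (v $ i) ^ k" using pos[of i] k by (intro self_le_power) auto
    also have "\<dots> \<le> (\<Sum>i\<in>UNIV. (v $ i) ^ k)"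
      using pos by (intro member_le_sum) (auto intro!: zero_le_power less_imp_le)
    finally show "v $ i \<le> int N" using v' by (simp add: pos_solutions_def)
  qed
  have "log_weight v \<le> (\<Prod>i\<in>(UNIV::'n set). ln (real N))"
    unfolding log_weight_def
  proof (intro prod_mono conjI)
    fix i
    show "0 \<le> ln (real_of_int (v $ i))" using vi(1)[of i] by (intro ln_ge_zero) linarith
    show "ln (real_of_int (v $ i)) \<le> ln (real N)" using vi[of i] by (subst ln_le_cancel_iff) linarith+
  qed
  then show ?thesis by simp
qed

text \<open>Keeps \<open>ln (real N)\<close> at least \<open>ln 2\<close>, so that constants can be
  absorbed into its powers.\<close>

lemma prime_rep_pos_imp_ge_2:
  assumes "prime_rep TYPE('n::finite) k N > 0" "0 < k"
  shows "2 \<le> N"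
proof -
  have "(prime_vectors k N :: (int ^ 'n) set) \<noteq> {}"
    using assms(1) by (auto simp: prime_rep_def)
  then obtain v :: "int ^ 'n" where v: "v \<in> prime_vectors k N" by blast
  obtain i :: 'n where True by blast
  have p: "2 \<le> v $ i" for i using v by (auto simp: prime_vectors_def dest!: spec prime_ge_2_int)
  have "2 \<le> v $ i" by (rule p)
  also have "v $ i \<le> (v $ i) ^ k" using p[of i] assms(2) by (intro self_le_power) auto
  also have "\<dots> \<le> (\<Sum>i\<in>UNIV. (v $ i) ^ k)"
    using p by (intro member_le_sum) (auto intro!: zero_le_power order_trans[OF _ p])
  finally show ?thesis using v by (simp add: prime_vectors_def)
qed

text \<open>The kernel of the average is a probability weight on the prime solutions with maximum at
  most \<open>ln N ^ CARD('n) / prime_rep\<close>, so the bilinear estimate applies and duality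
  transfers it.\<close>

lemma prime_avg_lp_improving:
  fixes f :: "int ^ 'n::finite \<Rightarrow> complex" and N :: nat
  assumes k: "2 \<le> k" and m: "m = CARD('n) * (k + 2) + 1" and n: "2 * k + 1 \<le> CARD('n)"
    and P: "prime_rep TYPE('n) k N > 0" and D: "D = real N powr (real CARD('n) / real k - 1)"
    and p: "1 < p" "p < 2" and p': "1 / p + 1 / p' = 1" and \<eta>: "\<eta> \<le> p - 1" "\<eta> \<le> 1 - p / 2"
    and f: "in_lp p f"
  shows "in_lp p' (prime_avg k N f) \<and> lp_norm p' (prime_avg k N f) \<le> D powr (1 - 2 / p) *
    (real N powr (- \<eta> / (32 * real k * real m)) *
      (2 + ln (real N) ^ CARD('n) / prime_rep TYPE('n) k N * D * (real m + 1))) * lp_norm p f"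
proof -
  define S where "S = (prime_vectors k N :: (int ^ 'n) set)"
  define P where "P = prime_rep TYPE('n) k N"
  define K where "K v = (if v \<in> S then log_weight v / P else 0)" for v
  have N: "2 \<le> N" using prime_rep_pos_imp_ge_2[OF P] k by simp
  have P0: "0 < P" using P by (simp add: P_def)
  have S: "S \<subseteq> pos_solutions k N" unfolding S_def by (rule prime_vectors_subset)
  have finS: "finite S" by (rule finite_subset[OF S card_pos_solutions(1)]) (use k in simp)
  have D0: "0 < D" using N by (simp add: D)
  have lw: "0 \<le> log_weight v" if "v \<in> S" for v
    using that unfolding S_def by (rule log_weight_nonneg)
  have K0: "0 \<le> K z" for z using P0 by (auto simp: K_def S_def intro!: divide_nonneg_pos log_weight_nonneg)
  have K\<kappa>: "K z \<le> ln (real N) ^ CARD('n) / P" for z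
    using P0 log_weight_le[of z k N] k N by (auto simp: K_def S_def divide_right_mono)
  have KS: "K z = 0" if "z \<notin> S" for z using that by (simp add: K_def)
  have K1: "sum K Z \<le> 1" if "finite Z" for Z
  proof -
    have "sum K Z = sum K (Z \<inter> S)" using that KS by (intro sum.mono_neutral_right) auto
    also have "\<dots> \<le> sum K S" using finS K0 by (intro sum_mono2) auto
    also have "\<dots> = (\<Sum>v\<in>S. log_weight v) / P"
      by (simp add: K_def sum_divide_distrib)
    also have "\<dots> = 1" using P0 by (simp add: P_def prime_rep_def S_def)
    finally show ?thesis .
  qed
  have g: "norm (prime_avg k N f l) \<le> (\<Sum>v\<in>S. K v * norm (f (v - l)))" for l
  proof -
    have "norm (prime_avg k N f l) = 1 / P * norm (\<Sum>v\<in>S. log_weight v *\<^sub>R f (v - l))"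
      using P0 by (simp add: prime_avg_def P_def S_def)
    also have "\<dots> \<le> 1 / P * (\<Sum>v\<in>S. log_weight v * norm (f (v - l)))"
      using P0 lw by (intro mult_left_mono sum_norm_le) auto
    also have "\<dots> = (\<Sum>v\<in>S. K v * norm (f (v - l)))"
      by (simp add: K_def sum_divide_distrib)
    finally show ?thesis .
  qed
  show ?thesis
    unfolding P_def[symmetric]
    by (rule lp_improving_of_bilinear[OF p(1) p' D0 finS K0 _ f g],
        rule bilinear_power_saving[OF k m n _ D _ _ S K0 K\<kappa> KS K1 _ _ _ _ p \<eta>])
       (use N in auto)
qed

text \<open>For large N the asymptotic makes the count at least half its main term, and the singular
  series is at least \<open>c\<close>. The finitely many remaining N are absorbed into the
  constant.\<close>

lemma hua_progression_lower_bound: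
  assumes "hua_progression TYPE('n::finite) k \<Gamma>"
  shows "\<exists>C>0. \<forall>N\<in>\<Gamma>. prime_rep TYPE('n) k N > 0 \<longrightarrow>
    real N powr (real CARD('n) / real k - 1) \<le> C * prime_rep TYPE('n) k N"
proof -
  let ?D = "\<lambda>N. real N powr (real CARD('n) / real k - 1)"
  let ?P = "prime_rep TYPE('n) k"
  let ?s = "singular_series CARD('n) k"
  obtain c where c: "0 < c" "\<And>N. N \<in> \<Gamma> \<Longrightarrow> c \<le> ?s N"
    using assms by (auto simp: hua_progression_def)
  have "?P \<sim>[inf at_top (principal \<Gamma>)] (\<lambda>N. ?s N * ?D N)"
    using assms by (simp add: hua_progression_def)
  then have "((\<lambda>N. if ?P N = 0 \<and> ?s N * ?D N = 0 then 1 else ?P N / (?s N * ?D N)) \<longlongrightarrow> 1)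
      (inf at_top (principal \<Gamma>))"
    by (simp add: asymp_equiv_def)
  from order_tendstoD(1)[OF this, of "1 / 2"]
  have "eventually (\<lambda>N. N \<in> \<Gamma> \<longrightarrow>
      1 / 2 < (if ?P N = 0 \<and> ?s N * ?D N = 0 then 1 else ?P N / (?s N * ?D N))) at_top"
    by (simp add: eventually_inf_principal)
  then obtain N0 where N0: "\<And>N. N0 \<le> N \<Longrightarrow> N \<in> \<Gamma> \<Longrightarrow>
      1 / 2 < (if ?P N = 0 \<and> ?s N * ?D N = 0 then 1 else ?P N / (?s N * ?D N))"
    by (auto simp: eventually_at_top_linorder)
  \<comment> \<open>Summands with a vanishing count are 0 by the convention for division, so the sum
    dominates each ratio that matters.\<close>
  define B where "B = (\<Sum>N<N0. \<bar>?D N / ?P N\<bar>)"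
  have B0: "0 \<le> B" unfolding B_def by (intro sum_nonneg) auto
  show ?thesis
  proof (intro exI[of _ "2 / c + B"] conjI ballI impI)
    show "0 < 2 / c + B" using c B0 by (intro add_pos_nonneg) auto
    fix N assume N: "N \<in> \<Gamma>" and P: "0 < ?P N"
    show "?D N \<le> (2 / c + B) * ?P N"
    proof (cases "N < N0")
      case True
      have "\<bar>?D N / ?P N\<bar> \<le> B" unfolding B_def using True by (intro member_le_sum) auto
      then have "?D N \<le> B * ?P N" using P by (simp add: pos_divide_le_eq)
      also have "\<dots> \<le> (2 / c + B) * ?P N" using P c by (intro mult_right_mono) auto
      finally show ?thesis .
    next
      case False
      have s: "c \<le> ?s N" using c N by blast
      have "?D N \<le> 2 / c * ?P N"
      proof (cases "?D N = 0")
        case True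
        have "0 \<le> 2 / c * ?P N" using P c by (intro mult_nonneg_nonneg) auto
        then show ?thesis by (simp only: True)
      next
        case False
        moreover have "0 \<le> ?D N" by (rule powr_ge_zero)
        ultimately have D: "0 < ?D N" by linarith
        have "1 / 2 < ?P N / (?s N * ?D N)" using N0[of N] \<open>\<not> N < N0\<close> N P by (simp only: not_less) simp
        moreover have "0 < ?s N * ?D N" using D s c by (intro mult_pos_pos) auto
        ultimately have "?s N * ?D N < 2 * ?P N" by (simp only: pos_less_divide_eq)
        moreover have "c * ?D N \<le> ?s N * ?D N" using s by (intro mult_right_mono) auto
        ultimately have "?D N * c \<le> 2 * ?P N" by (simp only: mult.commute[of _ c])
        then show ?thesis using c by (simp add: pos_le_divide_eq)
      qed
      also have "\<dots> \<le> (2 / c + B) * ?P N" using P B0 by (intro mult_right_mono) auto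
      finally show ?thesis .
    qed
  qed
qed

text \<open>By the lower bound for the count, the maximum of the kernel exceeds \<open>1 / D\<close>
  by at most a constant times \<open>ln N ^ CARD('n)\<close>. The estimate thus loses only
  logarithms and keeps a power of N.\<close>

lemma prime_avg_power_saving:
  fixes k :: nat and \<Gamma> :: "nat set" and p p' :: real
  assumes k: "2 \<le> k" and n: "2 * k + 1 \<le> CARD('n::finite)"
    and hua: "hua_progression TYPE('n) k \<Gamma>"
    and p: "1 < p" "p < 2" and p': "1 / p + 1 / p' = 1"
  shows "\<exists>C>0. \<exists>\<delta>>0. \<forall>N\<in>\<Gamma>. prime_rep TYPE('n) k N > 0 \<longrightarrow>
    (\<forall>f :: int ^ 'n \<Rightarrow> complex. in_lp p f \<longrightarrow>
      in_lp p' (prime_avg k N f) \<and>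
      lp_norm p' (prime_avg k N f) \<le>
        C * real N powr ((1 - real CARD('n) / real k) * (2 / p - 1))
          * (ln (real N) ^ CARD('n) * real N powr - \<delta>) * lp_norm p f)"
proof -
  define m where "m = CARD('n) * (k + 2) + 1"
  define \<eta> where "\<eta> = min (p - 1) (1 - p / 2)"
  define \<delta> where "\<delta> = \<eta> / (32 * real k * real m)"
  have "0 < m" unfolding m_def by simp
  moreover have "0 < \<eta>" using p by (simp add: \<eta>_def)
  ultimately have \<delta>: "0 < \<delta>" using k by (simp add: \<delta>_def)
  obtain C where C: "0 < C" "\<And>N. N \<in> \<Gamma> \<Longrightarrow> prime_rep TYPE('n) k N > 0 \<Longrightarrow>
      real N powr (real CARD('n) / real k - 1) \<le> C * prime_rep TYPE('n) k N"
    using hua_progression_lower_bound[OF hua] by blast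
  \<comment> \<open>The first summand absorbs the constant 2 into the power of \<open>ln N\<close>,
    using that N is at least 2.\<close>
  define C' where "C' = 2 / ln 2 ^ CARD('n) + C * (real m + 1)"
  show ?thesis
  proof (rule exI[of _ C'], rule conjI, goal_cases)
    case 1
    then show ?case using C by (auto simp: C'_def intro!: add_pos_pos)
  next
    case 2
    show ?case
    proof (rule exI[of _ \<delta>], intro conjI \<delta> ballI impI allI)
      fix N and f :: "int ^ 'n \<Rightarrow> complex"
      assume N: "N \<in> \<Gamma>" and P: "prime_rep TYPE('n) k N > 0" and f: "in_lp p f"
      let ?P = "prime_rep TYPE('n) k N"
      let ?L = "ln (real N) ^ CARD('n)"
      let ?D = "real N powr (real CARD('n) / real k - 1)"
      have avg: "in_lp p' (prime_avg k N f)"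
        "lp_norm p' (prime_avg k N f) \<le> ?D powr (1 - 2 / p) *
          (real N powr - \<delta> * (2 + ?L / ?P * ?D * (real m + 1))) * lp_norm p f"
        using prime_avg_lp_improving[OF k m_def n P refl p p' _ _ f, of \<eta>]
        by (simp_all add: \<eta>_def \<delta>_def)
      show "in_lp p' (prime_avg k N f)" by (rule avg)
      have N2: "2 \<le> N" using prime_rep_pos_imp_ge_2[OF P] k by simp
      have L: "ln 2 ^ CARD('n) \<le> ?L" using N2 by (intro power_mono) auto
      have "(2::real) = 2 / ln 2 ^ CARD('n) * ln 2 ^ CARD('n)" by simp
      also have "\<dots> \<le> 2 / ln 2 ^ CARD('n) * ?L" using L by (intro mult_left_mono) auto
      finally have 1: "2 \<le> 2 / ln 2 ^ CARD('n) * ?L" .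
      have 2: "?L / ?P * ?D \<le> C * ?L"
      proof -
        have "?D / ?P \<le> C" using C(2)[OF N P] P by (simp add: pos_divide_le_eq)
        then have "?L * (?D / ?P) \<le> ?L * C" using N2 by (intro mult_left_mono) auto
        then show ?thesis by (simp add: mult.commute)
      qed
      have "2 + ?L / ?P * ?D * (real m + 1) \<le> 2 / ln 2 ^ CARD('n) * ?L + C * ?L * (real m + 1)"
        by (intro add_mono mult_right_mono 1 2) auto
      also have "\<dots> = C' * ?L" by (simp add: C'_def algebra_simps)
      finally have 3: "2 + ?L / ?P * ?D * (real m + 1) \<le> C' * ?L" .
      have 4: "?D powr (1 - 2 / p) = real N powr ((1 - real CARD('n) / real k) * (2 / p - 1))"
        unfolding powr_powr by (rule arg_cong2[of _ _ _ _ "(powr)"]) (auto simp: algebra_simps)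
      have "lp_norm p' (prime_avg k N f) \<le> ?D powr (1 - 2 / p) *
          (real N powr - \<delta> * (2 + ?L / ?P * ?D * (real m + 1))) * lp_norm p f" by (rule avg)
      also have "\<dots> \<le> ?D powr (1 - 2 / p) * (real N powr - \<delta> * (C' * ?L)) * lp_norm p f"
        using 3 by (intro mult_left_mono mult_right_mono) (auto simp: lp_norm_def)
      finally show "lp_norm p' (prime_avg k N f) \<le>
          C' * real N powr ((1 - real CARD('n) / real k) * (2 / p - 1))
            * (?L * real N powr - \<delta>) * lp_norm p f"
        unfolding 4 by (simp only: ac_simps)
    qed
  qed
qed

section \<open>Trading the power of N for logarithms\<close>

text \<open>With \<open>r = n + B\<close>, the bound
  \<open>ln N \<le> (r / \<delta>) * N powr (\<delta> / r)\<close> is raised to the power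
  \<open>r\<close>.\<close>

lemma log_power_times_power_saving:
  assumes "0 < \<delta>" "0 < B"
  shows "\<exists>C>0. \<forall>N::nat\<ge>2. ln (real N) ^ n * real N powr - \<delta> \<le> C * ln (real N) powr - B"
proof -
  define r where "r = real n + B"
  have r: "0 < r" using assms by (simp add: r_def)
  show ?thesis
  proof (intro exI[of _ "(r / \<delta>) powr r"] conjI allI impI)
    show "0 < (r / \<delta>) powr r" using r assms by simp
    fix N :: nat assume N: "2 \<le> N"
    have ln: "0 < ln (real N)" using N by simp
    have "ln (real N) \<le> real N powr (\<delta> / r) / (\<delta> / r)"
      using N r assms by (intro ln_powr_bound) auto
    then have "ln (real N) powr r \<le> (r / \<delta> * real N powr (\<delta> / r)) powr r"
      using r ln by (intro powr_mono2) (auto simp: mult.commute)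
    also have "\<dots> = (r / \<delta>) powr r * real N powr \<delta>"
      using r assms by (subst powr_mult) (auto simp: powr_powr)
    finally have *: "ln (real N) powr r \<le> (r / \<delta>) powr r * real N powr \<delta>" .
    have "ln (real N) ^ n * real N powr - \<delta> = ln (real N) powr r * (ln (real N) powr - B * real N powr - \<delta>)"
      using ln by (simp add: r_def powr_add powr_minus powr_realpow)
    also have "\<dots> \<le> ((r / \<delta>) powr r * real N powr \<delta>) * (ln (real N) powr - B * real N powr - \<delta>)"
      by (intro mult_right_mono *) auto
    also have "\<dots> = (r / \<delta>) powr r * ln (real N) powr - B"
      using N by (simp add: powr_minus)
    finally show "ln (real N) ^ n * real N powr - \<delta> \<le> (r / \<delta>) powr r * ln (real N) powr - B" .
  qed
qed

theorem theorem2: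
  fixes k :: nat and \<Gamma> :: "nat set" and p p' :: real
  assumes "k \<ge> 2"
    and "int CARD('n::finite) \<ge> n\<^sub>0 k"
    and "hua_progression TYPE('n) k \<Gamma>"
    and "1 < p" and "p < 2" and "1 / p + 1 / p' = 1"
  shows "(k \<ge> 3 \<longrightarrow> (\<forall>B>0. \<exists>C::real. \<forall>N\<in>\<Gamma>. prime_rep TYPE('n) k N > 0 \<longrightarrow>
            (\<forall>f :: int ^ 'n \<Rightarrow> complex. in_lp p f \<longrightarrow>
               in_lp p' (prime_avg k N f) \<and>
               lp_norm p' (prime_avg k N f)
                 \<le> C * real N powr ((1 - real CARD('n) / real k) * (2 / p - 1))
                     * ln (real N) powr (- B) * lp_norm p f)))
       \<and> (k = 2 \<longrightarrow> (\<exists>C::real. \<forall>N\<in>\<Gamma>. prime_rep TYPE('n) k N > 0 \<longrightarrow>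
            (\<forall>f :: int ^ 'n \<Rightarrow> complex. in_lp p f \<longrightarrow>
               in_lp p' (prime_avg k N f) \<and>
               lp_norm p' (prime_avg k N f)
                 \<le> C * real N powr ((1 - real CARD('n) / 2) * (2 / p - 1))
                     * ln (real N) ^ CARD('n) * lp_norm p f)))"
proof -
  have n: "2 * k + 1 \<le> CARD('n)"
    using threshold_ge[OF assms(1)] assms(2) by linarith
  let ?R = "\<lambda>N. real N powr ((1 - real CARD('n) / real k) * (2 / p - 1))"
  obtain C \<delta> where C: "0 < C" and \<delta>: "0 < \<delta>"
    and *: "\<And>N f. N \<in> \<Gamma> \<Longrightarrow> prime_rep TYPE('n) k N > 0 \<Longrightarrow> in_lp p f \<Longrightarrow>
      in_lp p' (prime_avg k N f) \<and> lp_norm p' (prime_avg k N (f :: int ^ 'n \<Rightarrow> complex)) \<le>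
        C * ?R N * (ln (real N) ^ CARD('n) * real N powr - \<delta>) * lp_norm p f"
    using prime_avg_power_saving[OF assms(1) n assms(3-6)] by blast
  have N2: "2 \<le> N" if "prime_rep TYPE('n) k N > 0" for N
    using prime_rep_pos_imp_ge_2[OF that] assms(1) by simp
  have transfer: "lp_norm p' (prime_avg k N f) \<le> C * c * ?R N * w * lp_norm p f"
    if "N \<in> \<Gamma>" "prime_rep TYPE('n) k N > 0" "in_lp p f"
      "ln (real N) ^ CARD('n) * real N powr - \<delta> \<le> c * w"
    for N c w and f :: "int ^ 'n \<Rightarrow> complex"
  proof -
    have "lp_norm p' (prime_avg k N f)
        \<le> C * ?R N * (ln (real N) ^ CARD('n) * real N powr - \<delta>) * lp_norm p f"
      using *[OF that(1-3)] by blast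
    also have "\<dots> \<le> C * ?R N * (c * w) * lp_norm p f"
      using C that(4) by (intro mult_right_mono mult_left_mono) (auto simp: lp_norm_def)
    finally show ?thesis by (simp only: ac_simps)
  qed
  show ?thesis
  proof (intro conjI impI allI)
    fix B :: real assume "0 < B"
    then obtain c where c: "\<forall>N::nat\<ge>2. ln (real N) ^ CARD('n) * real N powr - \<delta> \<le> c * ln (real N) powr - B"
      using log_power_times_power_saving[OF \<delta>] by blast
    show "\<exists>C::real. \<forall>N\<in>\<Gamma>. prime_rep TYPE('n) k N > 0 \<longrightarrow>
            (\<forall>f :: int ^ 'n \<Rightarrow> complex. in_lp p f \<longrightarrow>
               in_lp p' (prime_avg k N f) \<and>
               lp_norm p' (prime_avg k N f)
                 \<le> C * real N powr ((1 - real CARD('n) / real k) * (2 / p - 1))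
                     * ln (real N) powr (- B) * lp_norm p f)"
    proof (intro exI[of _ "C * c"] ballI impI allI conjI)
      fix N and f :: "int ^ 'n \<Rightarrow> complex"
      assume N: "N \<in> \<Gamma>" "prime_rep TYPE('n) k N > 0" "in_lp p f"
      show "in_lp p' (prime_avg k N f)" using *[OF N] by blast
      show "lp_norm p' (prime_avg k N f) \<le> C * c * ?R N * ln (real N) powr (- B) * lp_norm p f"
        using transfer[OF N] c N2[OF N(2)] by blast
    qed
  next
    assume k: "k = 2"
    \<comment> \<open>For squares the logarithmic power of the claim is the one already present, so
      the saving is simply bounded by 1.\<close>
    have "ln (real N) ^ CARD('n) * real N powr - \<delta> \<le> 1 * ln (real N) ^ CARD('n)" if "2 \<le> N" for N :: nat
    proof -
      have "real N powr - \<delta> \<le> real N powr 0" using that \<delta> by (intro powr_mono) auto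
      then show ?thesis using that by (simp add: mult_left_le)
    qed
    note bound = this
    show "\<exists>C::real. \<forall>N\<in>\<Gamma>. prime_rep TYPE('n) k N > 0 \<longrightarrow>
            (\<forall>f :: int ^ 'n \<Rightarrow> complex. in_lp p f \<longrightarrow>
               in_lp p' (prime_avg k N f) \<and>
               lp_norm p' (prime_avg k N f)
                 \<le> C * real N powr ((1 - real CARD('n) / 2) * (2 / p - 1))
                     * ln (real N) ^ CARD('n) * lp_norm p f)"
    proof (intro exI[of _ C] ballI impI allI conjI)
      fix N and f :: "int ^ 'n \<Rightarrow> complex"
      assume N: "N \<in> \<Gamma>" "prime_rep TYPE('n) k N > 0" "in_lp p f"
      show "in_lp p' (prime_avg k N f)" using *[OF N] by blast
      show "lp_norm p' (prime_avg k N f) \<le> C * real N powr ((1 - real CARD('n) / 2) * (2 / p - 1))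
          * ln (real N) ^ CARD('n) * lp_norm p f"
        using transfer[OF N bound[OF N2[OF N(2)]]] by (simp add: k)
    qed
  qed
qed

end
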